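(* Let $\ell\ge 1$ and $k\ge 2$ be integers with $(\ell,k)\neq(1,2)$. For each $i\in[k]=\{0,1,\ldots,k-1\}$, the set $S_i^k=\{v=v_0v_1\cdots v_{k\ell-1}\in V^\ell_k : v_0=i\}$ is an E$^\ell$-set of the graph $ST^\ell_k$; that is, every vertex $v\in V^\ell_k\setminus S_i^k$ has exactly $\ell$ neighbors in $S_i^k$. In particular, the graphs $ST^\ell_k$ form an E$^\ell$-chain.
   Context: For integers $\ell\ge1$, $k\ge2$, an $\ell$-set permutation is a string over the alphabet $[k]=\{0,\ldots,k-1\}$ containing exactly $\ell$ occurrences of each $i\in[k]$; $V^\ell_k$ denotes the set of all such strings (of length $k\ell$), i.e. all rearrangements of $0^\ell1^\ell\cdots(k-1)^\ell$. The star $\ell$-set transposition graph $ST^\ell_k$ has vertex set $V^\ell_k$, with $v=v_0\cdots v_{k\ell-1}$ adjacent to $w$ iff $w$ is obtained from $v$ by swapping the first entry $v_0$ with some entry $v_j$ ($1\le j\le k\ell-1$) such that $v_j\neq v_0$. For a graph $G$ and integer $\ell\ge1$, a set $S\subseteq V(G)$ is an efficient dominating$^\ell$-set (E$^\ell$-set) if every vertex of $V(G)\setminus S$ is adjacent to exactly $\ell$ vertices of $S$. An E$^\ell$-chain is a countable family of nested graphs each of which has an E$^\ell$-set. *)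

theory Defs
  imports "Graph_Theory.Graph_Theory"
begin

definition set_perms :: "nat \<Rightarrow> nat \<Rightarrow> nat list set" where
  "set_perms l k = {v. set v \<subseteq> {..<k} \<and> (\<forall>i<k. count_list v i = l)}"

definition star_graph :: "nat \<Rightarrow> nat \<Rightarrow> nat list pair_pre_digraph" where
  "star_graph l k =
     \<lparr> pverts = set_perms l k,
       parcs = {(v, w). v \<in> set_perms l k \<and> w \<in> set_perms l k \<and>
                  (\<exists>j. 1 \<le> j \<and> j \<le> k * l - 1 \<and> v ! j \<noteq> v ! 0 \<and>
                       w = v[0 := v ! j, j := v ! 0])} \<rparr>"

definition first_entry_set :: "nat \<Rightarrow> nat \<Rightarrow> nat \<Rightarrow> nat list set" where
  "first_entry_set l k i = {v \<in> set_perms l k. v ! 0 = i}"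

definition E_set :: "nat \<Rightarrow> ('a, 'b) pre_digraph \<Rightarrow> 'a set \<Rightarrow> bool" where
  "E_set l G S \<longleftrightarrow>
     S \<subseteq> verts G \<and> (\<forall>v \<in> verts G - S. card {w \<in> S. v \<rightarrow>\<^bsub>G\<^esub> w} = l)"

text \<open>Graphs with different vertex sets of strings are nested along embeddings:
  each member of the family is isomorphic to an induced subgraph of every later one.
  For a family indexed by a set of natural numbers this is equivalent to requiring it for
  consecutive members only, since embeddings compose.\<close>

definition E_chain :: "nat \<Rightarrow> nat set \<Rightarrow> (nat \<Rightarrow> ('a, 'b) pre_digraph) \<Rightarrow> bool" where
  "E_chain l K G \<longleftrightarrow>
     (\<forall>k \<in> K. graph (G k) \<and> (\<exists>S. E_set l (G k) S)) \<and>
     (\<forall>j \<in> K. \<forall>k \<in> K. j < k \<longrightarrow>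
        (\<exists>H. induced_subgraph H (G k) \<and> digraph_iso (G j) H))"

end

theory Submission
  imports Defs "HOL-Library.Multiset"
begin

text \<open>A neighbour of \<open>v\<close> with first entry \<open>i \<noteq> v\<^sub>0\<close> is determined by the position of the entry \<open>i\<close>
  that is brought to the front, and there are exactly \<open>\<ell>\<close> such positions. The graph on \<open>[j]\<close> embeds
  into the graph on \<open>[k]\<close>, for \<open>j < k\<close>, by appending the fixed word \<open>j\<^sup>\<ell> \<dots> (k-1)\<^sup>\<ell>\<close>. The image is
  induced, since a swap with a position of the appended word puts a letter outside \<open>[j]\<close> at the
  front.\<close>

definition swap_first :: "'a list \<Rightarrow> nat \<Rightarrow> 'a list" where
  "swap_first v p = v[0 := v ! p, p := v ! 0]"

lemma length_swap_first [simp]: "length (swap_first v p) = length v"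
  by (simp add: swap_first_def)

lemma mset_swap_first: "p < length v \<Longrightarrow> mset (swap_first v p) = mset v"
  unfolding swap_first_def by (rule mset_swap) auto

lemma nth_swap_first:
  assumes "p < length v" "q < length v"
  shows "swap_first v p ! q = (if q = p then v ! 0 else if q = 0 then v ! p else v ! q)"
  using assms by (auto simp: swap_first_def nth_list_update)

lemma swap_first_nth_0: "p < length v \<Longrightarrow> swap_first v p ! 0 = v ! p"
  by (cases v; cases p) (auto simp: swap_first_def)

lemma swap_first_swap_first: "p < length v \<Longrightarrow> swap_first (swap_first v p) p = v"
  by (rule nth_equalityI) (auto simp: nth_swap_first swap_first_nth_0)

lemma swap_first_append:
  "p < length v \<Longrightarrow> swap_first (v @ s) p = swap_first v p @ s"
  by (auto simp: swap_first_def list_update_append nth_append)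

text \<open>The position can be read off from the result: after the swap with \<open>p\<close>,
  position \<open>p\<close> holds \<open>v ! 0\<close>, whereas a swap with any other position that
  carries \<open>i\<close> leaves the letter \<open>i\<close> there.\<close>

lemma inj_on_swap_first:
  assumes "v ! 0 \<noteq> i"
  shows "inj_on (swap_first v) {p. p < length v \<and> v ! p = i}"
proof (rule inj_onI)
  fix p q
  assume *: "p \<in> {p. p < length v \<and> v ! p = i}" "q \<in> {p. p < length v \<and> v ! p = i}"
    and eq: "swap_first v p = swap_first v q"
  show "p = q"
  proof (rule ccontr)
    assume "p \<noteq> q"
    have "v ! 0 = swap_first v p ! p"
      using * by (simp add: nth_swap_first)
    also have "\<dots> = swap_first v q ! p"
      by (simp add: eq)
    also have "\<dots> = i"
      using * \<open>p \<noteq> q\<close> assms by (auto simp: nth_swap_first)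
    finally show False
      using assms by simp
  qed
qed

text \<open>Only letter counts enter \<open>set_perms\<close>, so rearranging a word, in particular
  by a swap, does not leave it.\<close>

lemma set_perms_mset_cong:
  assumes "mset v = mset w"
  shows "v \<in> set_perms l k \<longleftrightarrow> w \<in> set_perms l k"
  using assms mset_eq_setD[OF assms] by (simp add: set_perms_def flip: count_mset)

lemma swap_first_in_set_perms:
  "p < length v \<Longrightarrow> v \<in> set_perms l k \<Longrightarrow> swap_first v p \<in> set_perms l k"
  using set_perms_mset_cong[OF mset_swap_first] by blast

lemma length_set_perms:
  assumes "v \<in> set_perms l k"
  shows "length v = k * l"
proof -
  have "length v = sum (count_list v) {..<k}"
    using assms by (intro sum_count_set[symmetric]) (auto simp: set_perms_def)
  also have "\<dots> = k * l"
    using assms by (simp add: set_perms_def)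
  finally show ?thesis .
qed

lemma finite_set_perms: "finite (set_perms l k)"
proof (rule finite_subset)
  show "set_perms l k \<subseteq> {v. set v \<subseteq> {..<k} \<and> length v = k * l}"
    using length_set_perms by (auto simp: set_perms_def)
qed (simp add: finite_lists_length_eq)

lemma pverts_star_graph [simp]: "pverts (star_graph l k) = set_perms l k"
  by (simp add: star_graph_def)

text \<open>Swaps preserve \<open>set_perms\<close>, and \<open>v ! p \<noteq> v ! 0\<close> forces
  \<open>1 \<le> p\<close>; this recovers the membership of \<open>w\<close> and the lower bound on
  the position.\<close>

lemma parcs_star_graph_iff:
  "(v, w) \<in> parcs (star_graph l k) \<longleftrightarrow>
     v \<in> set_perms l k \<and> (\<exists>p<length v. v ! p \<noteq> v ! 0 \<and> w = swap_first v p)"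
  (is "?L \<longleftrightarrow> ?R")
proof
  assume ?L
  then obtain p where p: "v \<in> set_perms l k" "1 \<le> p" "p \<le> k * l - 1"
      "v ! p \<noteq> v ! 0" "w = swap_first v p"
    by (auto simp: star_graph_def swap_first_def)
  \<comment> \<open>The subtraction is truncated, but \<open>1 \<le> p \<le> k * l - 1\<close>
    forces \<open>k * l\<close> to be positive.\<close>
  then have "p < length v"
    using length_set_perms[OF p(1)] by linarith
  with p show ?R by blast
next
  assume ?R
  then obtain p where p: "v \<in> set_perms l k" "p < length v" "v ! p \<noteq> v ! 0" "w = swap_first v p"
    by blast
  then have "1 \<le> p"
    by (cases p) auto
  moreover have "p \<le> k * l - 1"
    using length_set_perms[OF p(1)] p(2) by linarith
  ultimately show ?L
    using p swap_first_in_set_perms[OF p(2,1)]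
    by (auto simp: star_graph_def swap_first_def)
qed

lemma parcs_star_graph_in_set_perms:
  assumes "(v, w) \<in> parcs (star_graph l k)"
  shows "v \<in> set_perms l k" "w \<in> set_perms l k"
  using assms by (auto simp: star_graph_def)

text \<open>A swap is undone by the swap with the same position, where the two letters still
  differ.\<close>

lemma sym_parcs_star_graph:
  assumes "(v, w) \<in> parcs (star_graph l k)"
  shows "(w, v) \<in> parcs (star_graph l k)"
proof -
  from assms obtain p where p: "p < length v" "v ! p \<noteq> v ! 0" "w = swap_first v p"
    by (auto simp: parcs_star_graph_iff)
  then have "w ! p \<noteq> w ! 0" "v = swap_first w p"
    by (simp_all add: nth_swap_first swap_first_nth_0 swap_first_swap_first)
  moreover have "p < length w"
    using p by simp
  ultimately show ?thesis
    using parcs_star_graph_in_set_perms(2)[OF assms] unfolding parcs_star_graph_iff by blast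
qed

lemma graph_star_graph: "graph (with_proj (star_graph l k))"
proof -
  interpret pair_wf_digraph "star_graph l k"
    by unfold_locales (auto dest: parcs_star_graph_in_set_perms)
  have "parcs (star_graph l k) \<subseteq> set_perms l k \<times> set_perms l k"
    by (auto dest: parcs_star_graph_in_set_perms)
  then have "finite (parcs (star_graph l k))"
    by (rule finite_subset) (simp add: finite_set_perms)
  moreover have "symmetric (with_proj (star_graph l k))"
    by (auto simp: symmetric_def sym_parcs_star_graph intro!: symI)
  \<comment> \<open>The first entry changes along every arc, so there are no loops.\<close>
  moreover have "v \<noteq> w" if "(v, w) \<in> parcs (star_graph l k)" for v w
    using that by (metis parcs_star_graph_iff swap_first_nth_0)
  ultimately interpret pair_graph "star_graph l k"
    by unfold_locales (auto simp: finite_set_perms)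
  show ?thesis
    by (rule pair_graphD_graph)
qed

lemma E_set_first_entry_set:
  assumes "i < k"
  shows "E_set l (with_proj (star_graph l k)) (first_entry_set l k i)"
  unfolding E_set_def
proof (intro conjI ballI)
  show "first_entry_set l k i \<subseteq> verts (with_proj (star_graph l k))"
    by (auto simp: first_entry_set_def)
next
  fix v
  assume "v \<in> verts (with_proj (star_graph l k)) - first_entry_set l k i"
  then have v: "v \<in> set_perms l k" "v ! 0 \<noteq> i"
    by (auto simp: first_entry_set_def)
  let ?P = "{p. p < length v \<and> v ! p = i}"
  \<comment> \<open>As \<open>v ! 0 \<noteq> i\<close>, every position carrying \<open>i\<close>
    yields an arc, and only such a position brings \<open>i\<close> to the front.\<close>
  have "{w \<in> first_entry_set l k i. v \<rightarrow>\<^bsub>with_proj (star_graph l k)\<^esub> w} = swap_first v ` ?P"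
    using v by (auto simp: first_entry_set_def parcs_star_graph_iff swap_first_nth_0
        swap_first_in_set_perms)
  also have "card \<dots> = card ?P"
    by (rule card_image[OF inj_on_swap_first[OF v(2)]])
  also have "\<dots> = count_list v i"
    by (simp add: count_list_eq_length_filter length_filter_conv_card eq_commute)
  also have "\<dots> = l"
    using v(1) assms by (simp add: set_perms_def)
  finally show "card {w \<in> first_entry_set l k i. v \<rightarrow>\<^bsub>with_proj (star_graph l k)\<^esub> w} = l" .
qed

definition pad_word :: "nat \<Rightarrow> nat \<Rightarrow> nat \<Rightarrow> nat list" where
  "pad_word l j k = concat (map (replicate l) [j..<k])"

lemma set_pad_word: "set (pad_word l j k) \<subseteq> {j..<k}"
  by (auto simp: pad_word_def)

lemma count_list_replicate: "count_list (replicate n x) y = (if x = y then n else 0)"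
  by (induction n) auto

lemma count_list_pad_word:
  "j \<le> k \<Longrightarrow> count_list (pad_word l j k) i = (if i \<in> {j..<k} then l else 0)"
  unfolding pad_word_def
  by (induction k rule: dec_induct) (auto simp: count_list_replicate)

lemma append_pad_word_in_set_perms:
  assumes "v \<in> set_perms l j" "j \<le> k"
  shows "v @ pad_word l j k \<in> set_perms l k"
proof -
  \<comment> \<open>The letters of \<open>v\<close> and of the appended word are disjoint, so no
    count exceeds \<open>l\<close>.\<close>
  have "count_list v i = 0" if "\<not> i < j" for i
    using assms(1) that by (auto simp: set_perms_def count_list_0_iff)
  then show ?thesis
    using assms set_pad_word[of l j k] by (fastforce simp: set_perms_def count_list_pad_word)
qed

lemma append_pad_word_adjacent_iff:
  assumes "v \<in> set_perms l j" "w \<in> set_perms l j" "j \<le> k" "1 \<le> j" "1 \<le> l"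
  shows "(v @ pad_word l j k, w @ pad_word l j k) \<in> parcs (star_graph l k) \<longleftrightarrow>
           (v, w) \<in> parcs (star_graph l j)" (is "?L \<longleftrightarrow> ?R")
proof
  let ?s = "pad_word l j k"
  \<comment> \<open>Both words have length \<open>j * l\<close>, which is positive; so the first
    entry of a padded word comes from the unpadded part.\<close>
  have len: "length v = length w" "0 < length w"
    using assms by (auto simp: length_set_perms)
  assume ?L
  then obtain p where p: "p < length (v @ ?s)" "(v @ ?s) ! p \<noteq> (v @ ?s) ! 0"
      "w @ ?s = swap_first (v @ ?s) p"
    unfolding parcs_star_graph_iff by blast
  \<comment> \<open>The letter brought to the front is located by its size: it starts
    \<open>w\<close>, hence is below \<open>j\<close>, while every appended letter is at least
    \<open>j\<close>.\<close>
  have "w ! 0 = (v @ ?s) ! p"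
    using p(1) len swap_first_nth_0[OF p(1)] by (simp add: nth_append flip: p(3))
  moreover have "w ! 0 < j"
    using assms(2) nth_mem[OF len(2)] by (auto simp: set_perms_def)
  moreover have "(v @ ?s) ! p \<ge> j" if "\<not> p < length v"
  proof -
    have "?s ! (p - length v) \<in> set ?s"
      using p(1) that by (intro nth_mem) auto
    with that set_pad_word[of l j k] show ?thesis
      by (auto simp: nth_append)
  qed
  ultimately have "p < length v"
    by force
  moreover have "v ! p \<noteq> v ! 0"
    using p(2) \<open>p < length v\<close> len by (simp add: nth_append_left)
  moreover have "w = swap_first v p"
    using p(3) \<open>p < length v\<close> by (simp add: swap_first_append)
  ultimately show ?R
    using assms(1) by (auto simp: parcs_star_graph_iff)
next
  assume ?R
  then obtain p where "p < length v" "v ! p \<noteq> v ! 0" "w = swap_first v p"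
    by (auto simp: parcs_star_graph_iff)
  then show ?L
    using append_pad_word_in_set_perms[OF assms(1,3)]
    by (auto simp: parcs_star_graph_iff swap_first_append nth_append intro!: exI[of _ p])
qed

lemma star_graph_embedding:
  assumes "j \<le> k" "1 \<le> j" "1 \<le> l"
  shows "\<exists>H. induced_subgraph H (with_proj (star_graph l k)) \<and>
             digraph_iso (with_proj (star_graph l j)) H"
proof -
  let ?G = "\<lambda>k. with_proj (star_graph l k)"
  let ?f = "\<lambda>v. v @ pad_word l j k"
  \<comment> \<open>Arcs are pairs of vertices, so the arc map applies the vertex map to both ends;
    keeping the projections as tail and head makes the image compatible with the larger
    graph.\<close>
  define h where "h = \<lparr>iso_verts = ?f, iso_arcs = map_prod ?f ?f, iso_head = snd, iso_tail = fst\<rparr>"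
  let ?H = "app_iso h (?G j)"
  interpret J: graph "?G j" by (rule graph_star_graph)
  interpret K: graph "?G k" by (rule graph_star_graph)
  have "inj ?f"
    by (auto intro: injI)
  then have iso: "J.digraph_isomorphism h"
    unfolding J.digraph_isomorphism_def
    by (auto simp: h_def J.wf_digraph intro: inj_on_subset[OF prod.inj_map] inj_on_subset)
  \<comment> \<open>This equality makes the image induced: an arc between two padded words comes
    from an arc between the unpadded ones.\<close>
  have arcs: "arcs ?H = {e \<in> arcs (?G k). tail (?G k) e \<in> verts ?H \<and> head (?G k) e \<in> verts ?H}"
    using append_pad_word_adjacent_iff[OF _ _ assms] parcs_star_graph_in_set_perms[of _ _ l j]
    by (fastforce simp: h_def)
  moreover have "verts ?H \<subseteq> verts (?G k)"
    using append_pad_word_in_set_perms[OF _ assms(1)] by (auto simp: h_def)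
  moreover have "compatible (?G k) ?H"
    by (simp add: compatible_def h_def)
  ultimately have "induced_subgraph ?H (?G k)"
    using J.wf_digraphI_app_iso[OF iso] K.wf_digraph
    by (intro induced_subgraphI subgraphI) auto
  with iso show ?thesis
    unfolding digraph_iso_def by blast
qed

theorem theorem1:
  fixes l :: nat
  assumes "l \<ge> 1"
  shows "(\<forall>k\<ge>2. (l, k) \<noteq> (1, 2) \<longrightarrow>
            (\<forall>i<k. E_set l (with_proj (star_graph l k)) (first_entry_set l k i))) \<and>
         E_chain l {k. k \<ge> 2 \<and> (l, k) \<noteq> (1, 2)} (\<lambda>k. with_proj (star_graph l k))"
proof -
  \<comment> \<open>The letter 0 belongs to every alphabet of the family, so the words starting with
    0 serve as witness.\<close>
  have "\<exists>S. E_set l (with_proj (star_graph l k)) S" if "k \<ge> 2" for k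
    using E_set_first_entry_set[of 0 k l] that by auto
  then show ?thesis
    using assms
    by (auto simp: E_chain_def E_set_first_entry_set graph_star_graph intro!: star_graph_embedding)
qed

end
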